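(* Let $\mathbb V = (\mathbb F(\mathbb V), \{{\bf z}_t\}_{t \in \mathbb T})$ be a positive space of dimension $r$. Fix a chart ${\bf z}_{t_0}$ of $\mathbb V$, and let $M(t_0)\subseteq \mathcal U^{\rm mono}(\mathbb V)$ denote the set of global monomials in this chart, i.e. $M(t_0)=\{{\bf z}_{t_0}^{\bf h}\mid {\bf h}\in\mathbb Z^r,\ {\bf z}_{t_0}^{\bf h}\in\mathcal U(\mathbb V)\}$. If $u\in \mathcal U^{\rm mono}(\mathbb V)$ is a global monomial on $\mathbb V$ and $u\notin M(t_0)$, then the following hold. (i) No global monomial in $M(t_0)$ appears (with non-zero coefficient) in the Laurent expansion of $u$ with respect to the chart ${\bf z}_{t_0}$. (ii) If $\{{\bf z}_{t_0}^{\bf h}\mid {\bf h}\in \mathbb N^r\}\subseteq M(t_0)$, then the Laurent expansion of $u$ with respect to ${\bf z}_{t_0}$ is a linear combination of proper Laurent monomials in ${\bf z}_{t_0}$.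
   Context: Here $\mathbb N=\mathbb Z_{\ge 0}$. For free generators ${\bf z}=(z_1,\ldots,z_r)$ of a rational function field over $\mathbb Q$, $\mathbb Q_{\rm sf}({\bf z})=\{F/H \mid 0\neq F,H\in\mathbb Z_{\geq 0}[z_1,\ldots,z_r]\}$. A positive space of dimension $r$ is a pair $\mathbb V=(\mathbb F,\{{\bf z}_t\}_{t\in\mathbb T})$, where $\mathbb F=\mathbb F(\mathbb V)$ is the field of rational functions in $r$ variables over $\mathbb Q$, $\mathbb T$ is a non-empty index set, and each ${\bf z}_t=(z_{1;t},\ldots,z_{r;t})$ is an ordered set of free generators of $\mathbb F$ over $\mathbb Q$, such that $\mathbb Q_{\rm sf}({\bf z}_t)=\mathbb Q_{\rm sf}({\bf z}_{t'})\subseteq\mathbb F$ for all $t,t'\in\mathbb T$. Each ${\bf z}_t$ is called a chart. The coordinate algebra is $\mathcal U(\mathbb V)=\bigcap_{t\in\mathbb T}\mathbb Z[z_{1;t}^{\pm1},\ldots,z_{r;t}^{\pm1}]$. A global monomial on $\mathbb V$ is an element of $\mathcal U(\mathbb V)$ of the form ${\bf z}_t^{\bf h}=z_{1;t}^{h_1}\cdots z_{r;t}^{h_r}$ for some $t\in\mathbb T$, ${\bf h}\in\mathbb Z^r$. The set of global monomials is $\mathcal U^{\rm mono}(\mathbb V)=\bigcup_{t\in\mathbb T}\{{\bf z}_t^{\bf h}\mid {\bf h}\in\mathbb Z^r,\ {\bf z}_t^{\bf h}\in\mathcal U(\mathbb V)\}$. The Laurent expansion of $u\in\mathcal U(\mathbb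 V)$ with respect to ${\bf z}_t$ is its expression as a Laurent polynomial in $\mathbb Z[z_{1;t}^{\pm1},\ldots,z_{r;t}^{\pm1}]$. A Laurent monomial $z_1^{h_1}\cdots z_r^{h_r}$ is proper if $h_i<0$ for some $i\in\{1,\ldots,r\}$. *)

theory Defs
  imports Complex_Main "HOL-Library.Poly_Mapping"
begin

text \<open>
  The ambient field is a type \<open>'a\<close> of class \<open>field_char_0\<close>, so it contains the rationals via
  \<^const>\<open>of_rat\<close>.  That it is a field of rational functions in \<open>r\<close> variables over the
  rationals is expressed by the existence of \<open>r\<close> free generators.  An ordered \<open>r\<close>-tuple
  of field elements is a function \<open>z :: nat \<Rightarrow> 'a\<close>, of which only the values on \<open>{1..r}\<close> matter.

  Exponent vectors are finitely supported functions with support in \<open>{1..r}\<close>: type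
  \<open>nat \<Rightarrow>\<^sub>0 nat\<close> for ordinary and \<open>nat \<Rightarrow>\<^sub>0 int\<close> for Laurent monomials.  Formal (Laurent)
  polynomials are finitely supported functions from exponent vectors to coefficients.
\<close>

definition exponents :: "nat \<Rightarrow> (nat \<Rightarrow>\<^sub>0 'e::zero) set" where
  "exponents r = {h. Poly_Mapping.keys h \<subseteq> {1..r}}"

definition polys :: "nat \<Rightarrow> ((nat \<Rightarrow>\<^sub>0 'e::zero) \<Rightarrow>\<^sub>0 'c::zero) set" where
  "polys r = {p. Poly_Mapping.keys p \<subseteq> exponents r}"

definition monom_val :: "(nat \<Rightarrow> 'a::field_char_0) \<Rightarrow> (nat \<Rightarrow>\<^sub>0 nat) \<Rightarrow> 'a" where
  "monom_val z m = (\<Prod>i\<in>Poly_Mapping.keys m. z i ^ Poly_Mapping.lookup m i)"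

definition laurent_monom_val :: "(nat \<Rightarrow> 'a::field_char_0) \<Rightarrow> (nat \<Rightarrow>\<^sub>0 int) \<Rightarrow> 'a" where
  "laurent_monom_val z h = (\<Prod>i\<in>Poly_Mapping.keys h. z i powi Poly_Mapping.lookup h i)"

definition rat_poly_val ::
    "(nat \<Rightarrow> 'a::field_char_0) \<Rightarrow> ((nat \<Rightarrow>\<^sub>0 nat) \<Rightarrow>\<^sub>0 rat) \<Rightarrow> 'a" where
  "rat_poly_val z p = (\<Sum>m\<in>Poly_Mapping.keys p. of_rat (Poly_Mapping.lookup p m) * monom_val z m)"

definition nat_poly_val ::
    "(nat \<Rightarrow> 'a::field_char_0) \<Rightarrow> ((nat \<Rightarrow>\<^sub>0 nat) \<Rightarrow>\<^sub>0 nat) \<Rightarrow> 'a" where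
  "nat_poly_val z p = (\<Sum>m\<in>Poly_Mapping.keys p. of_nat (Poly_Mapping.lookup p m) * monom_val z m)"

definition laurent_val ::
    "(nat \<Rightarrow> 'a::field_char_0) \<Rightarrow> ((nat \<Rightarrow>\<^sub>0 int) \<Rightarrow>\<^sub>0 int) \<Rightarrow> 'a" where
  "laurent_val z p = (\<Sum>h\<in>Poly_Mapping.keys p. of_int (Poly_Mapping.lookup p h) * laurent_monom_val z h)"

text \<open>The second conjunct says that the whole type is the field generated by \<open>z 1, ..., z r\<close>.\<close>

definition free_generators :: "nat \<Rightarrow> (nat \<Rightarrow> 'a::field_char_0) \<Rightarrow> bool" where
  "free_generators r z \<longleftrightarrow>
     (\<forall>p\<in>polys r. rat_poly_val z p = 0 \<longrightarrow> p = 0) \<and>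
     (\<forall>x. \<exists>p\<in>polys r. \<exists>q\<in>polys r. rat_poly_val z q \<noteq> 0 \<and> x = rat_poly_val z p / rat_poly_val z q)"

definition Q_sf :: "nat \<Rightarrow> (nat \<Rightarrow> 'a::field_char_0) \<Rightarrow> 'a set" where
  "Q_sf r z = {nat_poly_val z p / nat_poly_val z q | p q.
     p \<in> polys r \<and> q \<in> polys r \<and> p \<noteq> 0 \<and> q \<noteq> 0}"

definition positive_space :: "nat \<Rightarrow> 't set \<Rightarrow> ('t \<Rightarrow> nat \<Rightarrow> 'a::field_char_0) \<Rightarrow> bool" where
  "positive_space r T z \<longleftrightarrow>
     T \<noteq> {} \<and>
     (\<forall>t\<in>T. free_generators r (z t)) \<and>
     (\<forall>t\<in>T. \<forall>t'\<in>T. Q_sf r (z t) = Q_sf r (z t'))"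

definition laurent_ring :: "nat \<Rightarrow> (nat \<Rightarrow> 'a::field_char_0) \<Rightarrow> 'a set" where
  "laurent_ring r z = laurent_val z ` polys r"

definition coord_algebra :: "nat \<Rightarrow> 't set \<Rightarrow> ('t \<Rightarrow> nat \<Rightarrow> 'a::field_char_0) \<Rightarrow> 'a set" where
  "coord_algebra r T z = (\<Inter>t\<in>T. laurent_ring r (z t))"

definition chart_global_monomials ::
    "nat \<Rightarrow> 't set \<Rightarrow> ('t \<Rightarrow> nat \<Rightarrow> 'a::field_char_0) \<Rightarrow> 't \<Rightarrow> 'a set" where
  "chart_global_monomials r T z t =
     {laurent_monom_val (z t) h | h. h \<in> exponents r \<and> laurent_monom_val (z t) h \<in> coord_algebra r T z}"

definition global_monomials :: "nat \<Rightarrow> 't set \<Rightarrow> ('t \<Rightarrow> nat \<Rightarrow> 'a::field_char_0) \<Rightarrow> 'a set" where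
  "global_monomials r T z = (\<Union>t\<in>T. chart_global_monomials r T z t)"

text \<open>
  For free generators \<open>z\<close> the expansion is unique by algebraic independence; it exists exactly
  when \<open>u\<close> lies in \<^term>\<open>laurent_ring r z\<close>, in particular for \<open>u\<close> in the coordinate algebra.
\<close>

definition laurent_expansion ::
    "nat \<Rightarrow> (nat \<Rightarrow> 'a::field_char_0) \<Rightarrow> 'a \<Rightarrow> ((nat \<Rightarrow>\<^sub>0 int) \<Rightarrow>\<^sub>0 int)" where
  "laurent_expansion r z u = (THE p. p \<in> polys r \<and> laurent_val z p = u)"

definition proper_exponent :: "nat \<Rightarrow> (nat \<Rightarrow>\<^sub>0 int) \<Rightarrow> bool" where
  "proper_exponent r h \<longleftrightarrow> (\<exists>i\<in>{1..r}. Poly_Mapping.lookup h i < 0)"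

end

theory Submission
  imports Defs
begin

text \<open>
  Write \<open>x\<close>, \<open>y\<close> for the two charts, \<open>u = y\<^sup>g = P(x)\<close>, and suppose that \<open>P\<close> contains a monomial \<open>x\<^sup>h\<close> which
  is a Laurent polynomial \<open>D(y)\<close>.  Let \<open>v\<close> be the monomial valuation that gives \<open>y\<^sub>i\<close> the weight \<open>w\<^sub>i\<close>.  On
  subtraction-free elements \<open>v\<close> turns sums into minima, and these are the same elements for both
  charts, so there \<open>v\<close> is also monomial with respect to \<open>x\<close>.  Hence \<open>v(y\<^sup>g)\<close>, the minimum of \<open>v\<close> over the
  monomials of \<open>P(x)\<close>, is at most \<open>v(x\<^sup>h)\<close>, the minimum of \<open>v\<close> over the monomials of \<open>D(y)\<close>.
  Therefore \<open>\<langle>w, g\<rangle> \<le> \<langle>w, k\<rangle>\<close> for every exponent \<open>k\<close> of \<open>D\<close>, and \<open>w = g - k\<close> yields \<open>k = g\<close>.  So \<open>x\<^sup>h\<close> is an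
  integer multiple of \<open>u\<close>, and integrality and positivity make the factor \<open>1\<close>.
\<close>

type_synonym exponent = "nat \<Rightarrow>\<^sub>0 int"
type_synonym laurent = "exponent \<Rightarrow>\<^sub>0 int"

subsection \<open>Evaluation of Laurent polynomials\<close>

lemma sum_single_lookup:
  "(\<Sum>k\<in>Poly_Mapping.keys p. Poly_Mapping.single k (Poly_Mapping.lookup p k)) = p"
  by (intro poly_mapping_eqI)
     (auto simp: lookup_sum lookup_single when_def not_in_keys_iff_lookup_eq_zero)

lemma exponents_0 [simp]: "0 \<in> exponents r"
  by (simp add: exponents_def)

lemma exponents_add:
  fixes h k :: "nat \<Rightarrow>\<^sub>0 'e::monoid_add"
  shows "h \<in> exponents r \<Longrightarrow> k \<in> exponents r \<Longrightarrow> h + k \<in> exponents r"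
  using Poly_Mapping.keys_add[of h k] by (auto simp: exponents_def)

lemma lookup_exponents_eq_0:
  "h \<in> exponents r \<Longrightarrow> i \<notin> {1..r} \<Longrightarrow> Poly_Mapping.lookup h i = 0"
  unfolding exponents_def mem_Collect_eq using not_in_keys_iff_lookup_eq_zero[of i h] by blast

lemma exponents_map:
  assumes "h \<in> exponents r" "f 0 = 0"
  shows "Poly_Mapping.map f h \<in> exponents r"
proof -
  have "i \<in> {1..r}" if "i \<in> Poly_Mapping.keys (Poly_Mapping.map f h)" for i
  proof (rule ccontr)
    assume "i \<notin> {1..r}"
    then have "Poly_Mapping.lookup h i = 0"
      by (rule lookup_exponents_eq_0[OF assms(1)])
    then show False
      using that by (simp add: in_keys_iff map.rep_eq)
  qed
  then show ?thesis
    unfolding exponents_def by blast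
qed

lemma polys_add:
  fixes p q :: "(nat \<Rightarrow>\<^sub>0 'e::zero) \<Rightarrow>\<^sub>0 'c::monoid_add"
  shows "p \<in> polys r \<Longrightarrow> q \<in> polys r \<Longrightarrow> p + q \<in> polys r"
  using Poly_Mapping.keys_add[of p q] by (auto simp: polys_def)

lemma polys_0 [simp]: "0 \<in> polys r"
  by (simp add: polys_def)

lemma polys_sum:
  fixes f :: "'x \<Rightarrow> (nat \<Rightarrow>\<^sub>0 'e::zero) \<Rightarrow>\<^sub>0 'c::comm_monoid_add"
  shows "(\<And>x. x \<in> S \<Longrightarrow> f x \<in> polys r) \<Longrightarrow> sum f S \<in> polys r"
  by (induction S rule: infinite_finite_induct) (auto simp: polys_add)

lemma polys_uminus: "(p :: laurent) \<in> polys r \<Longrightarrow> - p \<in> polys r"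
  by (simp add: polys_def)

lemma polys_diff: "(p :: laurent) \<in> polys r \<Longrightarrow> q \<in> polys r \<Longrightarrow> p - q \<in> polys r"
  using polys_add[OF _ polys_uminus, of p r q] by simp

lemma polys_mult: "(p :: laurent) \<in> polys r \<Longrightarrow> q \<in> polys r \<Longrightarrow> p * q \<in> polys r"
  using Poly_Mapping.keys_mult[of p q] by (fastforce simp: polys_def intro: exponents_add)

lemma polys_single: "h \<in> exponents r \<Longrightarrow> Poly_Mapping.single h c \<in> polys r"
  by (simp add: polys_def)

section \<open>Evaluation of sums and of single monomials\<close>

lemma laurent_val_add: "laurent_val z (p + q) = laurent_val z p + laurent_val z q"
  unfolding laurent_val_def
  by (rule setsum_keys_plus_distrib) (auto simp: algebra_simps)

lemma laurent_val_0 [simp]: "laurent_val z 0 = 0"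
  by (simp add: laurent_val_def)

lemma laurent_val_uminus: "laurent_val z (- p) = - laurent_val z p"
  using laurent_val_add[of z p "- p"] by (simp add: eq_neg_iff_add_eq_0 add.commute)

lemma laurent_val_diff: "laurent_val z (p - q) = laurent_val z p - laurent_val z q"
  using laurent_val_add[of z p "- q"] by (simp add: laurent_val_uminus)

lemma laurent_val_sum: "laurent_val z (sum f S) = (\<Sum>x\<in>S. laurent_val z (f x))"
  by (induction S rule: infinite_finite_induct) (auto simp: laurent_val_add)

lemma laurent_val_single:
  "laurent_val z (Poly_Mapping.single h c) = of_int c * laurent_monom_val z h"
  by (simp add: laurent_val_def)

lemma rat_poly_val_add: "rat_poly_val z (p + q) = rat_poly_val z p + rat_poly_val z q"
  unfolding rat_poly_val_def
  by (rule setsum_keys_plus_distrib) (auto simp: algebra_simps of_rat_add)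

lemma rat_poly_val_sum: "rat_poly_val z (sum f S) = (\<Sum>x\<in>S. rat_poly_val z (f x))"
  by (induction S rule: infinite_finite_induct)
     (auto simp: rat_poly_val_add, simp_all add: rat_poly_val_def)

lemma rat_poly_val_single:
  "rat_poly_val z (Poly_Mapping.single h c) = of_rat c * monom_val z h"
  by (simp add: rat_poly_val_def)

lemma laurent_monom_val_0 [simp]: "laurent_monom_val z 0 = 1"
  by (simp add: laurent_monom_val_def)

lemma laurent_monom_val_exponents:
  "h \<in> exponents r \<Longrightarrow> laurent_monom_val z h = (\<Prod>i\<in>{1..r}. z i powi Poly_Mapping.lookup h i)"
  unfolding laurent_monom_val_def
  by (rule prod.mono_neutral_left) (auto simp: exponents_def in_keys_iff)

text \<open>Reduces ordinary monomials to Laurent ones, so that multiplicativity and nonvanishing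
  are proved only once.\<close>

lemma monom_val_conv_laurent:
  "monom_val z m = laurent_monom_val z (Poly_Mapping.map int m)"
proof -
  have "Poly_Mapping.keys (Poly_Mapping.map int m) = Poly_Mapping.keys m"
    by (rule set_eqI) (simp add: in_keys_iff map.rep_eq when_def)
  then show ?thesis
    unfolding monom_val_def laurent_monom_val_def
    by (auto intro!: prod.cong simp: map.rep_eq when_def in_keys_iff)
qed

section \<open>Consequences of algebraic independence\<close>

lemma free_generators_nonzero:
  fixes z :: "nat \<Rightarrow> 'a::field_char_0"
  assumes "free_generators r z" "i \<in> {1..r}"
  shows "z i \<noteq> 0"
proof
  assume "z i = 0"
  let ?m = "Poly_Mapping.single i (1 :: nat)"
  \<comment> \<open>The variable itself would be a nonzero polynomial relation.\<close>
  have "rat_poly_val z (Poly_Mapping.single ?m 1) = 0"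
    using \<open>z i = 0\<close> by (simp add: rat_poly_val_single monom_val_def)
  moreover have "Poly_Mapping.single ?m (1 :: rat) \<in> polys r"
    using assms(2) by (intro polys_single) (simp add: exponents_def)
  ultimately have "Poly_Mapping.single ?m (1 :: rat) = 0"
    using assms(1) unfolding free_generators_def by blast
  then show False
    by (metis lookup_single_eq lookup_zero zero_neq_one)
qed

lemma laurent_monom_val_add:
  assumes "free_generators r z" "h \<in> exponents r" "k \<in> exponents r"
  shows "laurent_monom_val z (h + k) = laurent_monom_val z h * laurent_monom_val z k"
  using assms free_generators_nonzero[OF assms(1)]
  by (auto simp: laurent_monom_val_exponents[of _ r] exponents_add lookup_add power_int_add
        prod.distrib[symmetric] simp del: atLeastAtMost_iff intro!: prod.cong)

lemma laurent_monom_val_nonzero: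
  assumes "free_generators r z" "h \<in> exponents r"
  shows "laurent_monom_val z h \<noteq> 0"
  using assms free_generators_nonzero[OF assms(1)]
  by (auto simp: laurent_monom_val_exponents[of _ r])

text \<open>Both factors are expanded into single terms; monomials multiply by
  \<open>laurent_monom_val_add\<close>, which rests on the generators being nonzero.\<close>

lemma laurent_val_mult:
  assumes "free_generators r z" "p \<in> polys r" "q \<in> polys r"
  shows "laurent_val z (p * q) = laurent_val z p * laurent_val z q"
proof -
  let ?s = "\<lambda>f h. Poly_Mapping.single h (Poly_Mapping.lookup f h)"
  have "p * q = (\<Sum>h\<in>Poly_Mapping.keys p. ?s p h) * (\<Sum>k\<in>Poly_Mapping.keys q. ?s q k)"
    by (simp only: sum_single_lookup)
  also have "laurent_val z \<dots> = (\<Sum>h\<in>Poly_Mapping.keys p. \<Sum>k\<in>Poly_Mapping.keys q.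
      laurent_val z (?s p h) * laurent_val z (?s q k))"
    using assms
    by (auto simp: sum_product laurent_val_sum mult_single laurent_val_single polys_def subset_iff
        laurent_monom_val_add[OF assms(1)] intro!: sum.cong)
  also have "\<dots> = laurent_val z p * laurent_val z q"
    by (simp add: sum_product[symmetric] laurent_val_sum[symmetric] sum_single_lookup)
  finally show ?thesis .
qed

text \<open>The sum of the absolute values of all exponents in \<open>K\<close> dominates each of
  them, so one shift clears all denominators at once.\<close>

lemma exists_exponent_shift:
  fixes K :: "exponent set"
  assumes "finite K" "K \<subseteq> exponents r"
  obtains n where "n \<in> exponents r" "\<And>h i. h \<in> K \<Longrightarrow> Poly_Mapping.lookup (h + n) i \<ge> 0"
proof
  let ?n = "\<Sum>h\<in>K. Poly_Mapping.map abs h"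
  have "T \<subseteq> K \<Longrightarrow> (\<Sum>h\<in>T. Poly_Mapping.map abs h) \<in> exponents r" for T
    using finite_subset[OF _ assms(1), of T] assms(2)
    by (induction T rule: infinite_finite_induct) (auto intro!: exponents_add exponents_map)
  then show "?n \<in> exponents r" by simp
next
  fix h :: exponent and i :: nat assume "h \<in> K"
  let ?f = "\<lambda>h :: exponent. Poly_Mapping.lookup (Poly_Mapping.map abs h) i"
  have f: "?f k = \<bar>Poly_Mapping.lookup k i\<bar>" for k :: exponent
    by (simp add: map.rep_eq when_def)
  have "\<bar>Poly_Mapping.lookup h i\<bar> \<le> (\<Sum>k\<in>K. ?f k)"
    using member_le_sum[of h K ?f] \<open>h \<in> K\<close> assms(1) by (simp add: f)
  then show "Poly_Mapping.lookup (h + (\<Sum>h\<in>K. Poly_Mapping.map abs h)) i \<ge> 0"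
    by (simp add: lookup_add lookup_sum)
qed

text \<open>\<open>free_generators\<close> only speaks of ordinary polynomials with rational
  coefficients. Multiplying by a monomial that clears the negative exponents turns a Laurent
  relation into such a relation.\<close>

lemma laurent_val_eq_0_iff:
  assumes fg: "free_generators r z" and p: "p \<in> polys r"
  shows "laurent_val z p = 0 \<longleftrightarrow> p = 0"
proof
  assume val: "laurent_val z p = 0"
  let ?K = "Poly_Mapping.keys p"
  have K: "?K \<subseteq> exponents r" using p by (simp add: polys_def)
  obtain n where n: "n \<in> exponents r" and
    nonneg: "\<And>h i. h \<in> ?K \<Longrightarrow> Poly_Mapping.lookup (h + n) i \<ge> 0"
    by (rule exists_exponent_shift[OF finite_keys K]) auto
  define m where "m h = Poly_Mapping.map nat (h + n)" for h
  have int_m: "Poly_Mapping.map int (m h) = h + n" if "h \<in> ?K" for h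
    using nonneg[OF that]
    by (intro poly_mapping_eqI) (auto simp: m_def map.rep_eq when_def not_le antisym)
  \<comment> \<open>Shifting is injective on the support, so distinct terms of \<open>p\<close>
    cannot merge in \<open>q\<close>.\<close>
  have m_eq: "m h = m k \<longleftrightarrow> h = k" if "h \<in> ?K" "k \<in> ?K" for h k
    using int_m that by (metis add_right_cancel)
  \<comment> \<open>\<open>q\<close> is \<open>p\<close> times the monomial with exponent
    \<open>n\<close>, recast as an ordinary polynomial.\<close>
  define q :: "(nat \<Rightarrow>\<^sub>0 nat) \<Rightarrow>\<^sub>0 rat"
    where "q = (\<Sum>h\<in>?K. Poly_Mapping.single (m h) (of_int (Poly_Mapping.lookup p h)))"
  have "rat_poly_val z q =
      (\<Sum>h\<in>?K. of_int (Poly_Mapping.lookup p h) * laurent_monom_val z h * laurent_monom_val z n)"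
    using K n by (auto simp: q_def rat_poly_val_sum rat_poly_val_single monom_val_conv_laurent int_m
        laurent_monom_val_add[OF fg] subset_iff intro!: sum.cong)
  also have "\<dots> = laurent_val z p * laurent_monom_val z n"
    by (simp add: laurent_val_def sum_distrib_right)
  finally have "rat_poly_val z q = 0" using val by simp
  moreover have "q \<in> polys r"
    unfolding q_def m_def using K n
    by (intro polys_sum polys_single exponents_map exponents_add) auto
  ultimately have "q = 0"
    using fg unfolding free_generators_def by blast
  have "h \<notin> ?K" for h
  proof
    assume h: "h \<in> ?K"
    have "Poly_Mapping.lookup q (m h) = (\<Sum>k\<in>?K. of_int (Poly_Mapping.lookup p k) when k = h)"
      using h by (auto simp: q_def lookup_sum lookup_single m_eq when_def intro!: sum.cong)
    also have "\<dots> = of_int (Poly_Mapping.lookup p h)"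
      using h by (simp add: when_def)
    finally show False using h \<open>q = 0\<close> by (simp add: in_keys_iff)
  qed
  then show "p = 0" by (metis all_not_in_conv keys_eq_empty)
qed simp

lemma laurent_val_inj:
  assumes "free_generators r z" "p \<in> polys r" "q \<in> polys r" "laurent_val z p = laurent_val z q"
  shows "p = q"
  using laurent_val_eq_0_iff[OF assms(1) polys_diff[OF assms(2,3)]] assms(4)
  by (simp add: laurent_val_diff)

lemma laurent_expansion_laurent_val:
  assumes "free_generators r z" "p \<in> polys r"
  shows "laurent_expansion r z (laurent_val z p) = p"
  unfolding laurent_expansion_def
  by (rule the_equality) (use assms laurent_val_inj in auto)

subsection \<open>Monomial valuations\<close>

definition weight :: "nat \<Rightarrow> (nat \<Rightarrow> int) \<Rightarrow> exponent \<Rightarrow> int" where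
  "weight r w h = (\<Sum>i\<in>{1..r}. w i * Poly_Mapping.lookup h i)"

text \<open>At \<open>p = 0\<close> this is \<open>Min {}\<close>, so it is meaningful only for
  nonzero \<open>p\<close>.\<close>

definition min_weight :: "nat \<Rightarrow> (nat \<Rightarrow> int) \<Rightarrow> laurent \<Rightarrow> int" where
  "min_weight r w p = Min (weight r w ` Poly_Mapping.keys p)"

lemma weight_0 [simp]: "weight r w 0 = 0"
  by (simp add: weight_def)

lemma weight_add: "weight r w (h + k) = weight r w h + weight r w k"
  by (simp add: weight_def lookup_add algebra_simps sum.distrib)

lemma weight_diff: "weight r w (h - k) = weight r w h - weight r w k"
  by (simp add: weight_def lookup_minus algebra_simps sum_subtractf)

lemma min_weight_le: "h \<in> Poly_Mapping.keys p \<Longrightarrow> min_weight r w p \<le> weight r w h"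
  by (simp add: min_weight_def)

lemma min_weight_eqI:
  "h \<in> Poly_Mapping.keys p \<Longrightarrow> weight r w h = n \<Longrightarrow>
    (\<And>k. k \<in> Poly_Mapping.keys p \<Longrightarrow> n \<le> weight r w k) \<Longrightarrow> min_weight r w p = n"
  unfolding min_weight_def by (rule Min_eqI) auto

lemma min_weight_attained:
  assumes "p \<noteq> 0"
  obtains h where "h \<in> Poly_Mapping.keys p" "weight r w h = min_weight r w p"
proof -
  have "min_weight r w p \<in> weight r w ` Poly_Mapping.keys p"
    unfolding min_weight_def using assms by (intro Min_in) simp_all
  then show thesis using that by auto
qed

lemma min_weight_single: "c \<noteq> 0 \<Longrightarrow> min_weight r w (Poly_Mapping.single h c) = weight r w h"
  by (simp add: min_weight_def)

text \<open>The initial form of \<open>p\<close> is the part \<open>p'\<close> of minimal weight; the product of two initial forms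
  does not vanish and cannot be cancelled by the terms of larger weight.\<close>

lemma initial_form_split:
  assumes "p \<noteq> 0"
  obtains p' p'' where "p = p' + p''" "p' \<noteq> 0"
    "\<And>h. h \<in> Poly_Mapping.keys p' \<Longrightarrow> weight r w h = min_weight r w p"
    "\<And>h. h \<in> Poly_Mapping.keys p'' \<Longrightarrow> weight r w h > min_weight r w p"
proof -
  let ?m = "min_weight r w p"
  define p' where "p' = (\<Sum>h\<in>{h \<in> Poly_Mapping.keys p. weight r w h = ?m}.
    Poly_Mapping.single h (Poly_Mapping.lookup p h))"
  have lookup_p': "Poly_Mapping.lookup p' h = (if weight r w h = ?m then Poly_Mapping.lookup p h else 0)"
    for h by (auto simp: p'_def lookup_sum lookup_single when_def in_keys_iff)
  obtain h where h: "h \<in> Poly_Mapping.keys p" "weight r w h = ?m"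
    using min_weight_attained[OF assms] .
  show thesis
  proof
    show "p = p' + (p - p')" by simp
    show "p' \<noteq> 0"
      using h lookup_p'[of h] by (auto simp: in_keys_iff)
    show "weight r w h = ?m" if "h \<in> Poly_Mapping.keys p'" for h
      using that lookup_p'[of h] by (auto simp: in_keys_iff split: if_splits)
    show "weight r w h > ?m" if "h \<in> Poly_Mapping.keys (p - p')" for h
    proof -
      have "h \<in> Poly_Mapping.keys p" "weight r w h \<noteq> ?m"
        using that lookup_p'[of h] by (auto simp: in_keys_iff lookup_minus split: if_splits)
      with min_weight_le[of h p r w] show ?thesis by simp
    qed
  qed
qed

lemma min_weight_mult:
  assumes "p \<noteq> 0" "q \<noteq> 0"
  shows "min_weight r w (p * q) = min_weight r w p + min_weight r w q"
proof -
  let ?m = "min_weight r w p" and ?n = "min_weight r w q"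
  obtain p' p'' where p: "p = p' + p''" "p' \<noteq> 0"
    and p': "\<And>h. h \<in> Poly_Mapping.keys p' \<Longrightarrow> weight r w h = ?m"
    and p'': "\<And>h. h \<in> Poly_Mapping.keys p'' \<Longrightarrow> weight r w h > ?m"
    using initial_form_split[OF assms(1)] by metis
  obtain q' q'' where q: "q = q' + q''" "q' \<noteq> 0"
    and q': "\<And>h. h \<in> Poly_Mapping.keys q' \<Longrightarrow> weight r w h = ?n"
    and q'': "\<And>h. h \<in> Poly_Mapping.keys q'' \<Longrightarrow> weight r w h > ?n"
    using initial_form_split[OF assms(2)] by metis
  \<comment> \<open>Formal Laurent polynomials have no zero divisors. Any exponent of this product
    will attain the minimum for \<open>p * q\<close>.\<close>
  have "p' * q' \<noteq> 0" using p(2) q(2) by simp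
  then obtain k where k: "k \<in> Poly_Mapping.keys (p' * q')"
    by (metis all_not_in_conv keys_eq_empty)
  obtain a b where "k = a + b" "a \<in> Poly_Mapping.keys p'" "b \<in> Poly_Mapping.keys q'"
    using k keys_mult[of p' q'] by blast
  then have wk: "weight r w k = ?m + ?n" by (simp add: weight_add p' q')
  have "k \<notin> Poly_Mapping.keys (p' * q'')"
  proof
    assume "k \<in> Poly_Mapping.keys (p' * q'')"
    then obtain a b where "k = a + b" "a \<in> Poly_Mapping.keys p'" "b \<in> Poly_Mapping.keys q''"
      using keys_mult[of p' q''] by blast
    then show False using wk p'[of a] q''[of b] by (simp add: weight_add)
  qed
  moreover have "k \<notin> Poly_Mapping.keys (p'' * q)"
  proof
    assume "k \<in> Poly_Mapping.keys (p'' * q)"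
    then obtain a b where "k = a + b" "a \<in> Poly_Mapping.keys p''" "b \<in> Poly_Mapping.keys q"
      using keys_mult[of p'' q] by blast
    then show False using wk p''[of a] min_weight_le[of b q r w] by (simp add: weight_add)
  qed
  \<comment> \<open>Keeping \<open>q\<close> whole in the last product leaves only two remainders,
    and both consist of terms of weight greater than \<open>?m + ?n\<close>.\<close>
  moreover have "p * q = p' * q' + (p' * q'' + p'' * q)"
    by (simp add: p(1) q(1) algebra_simps)
  ultimately have "k \<in> Poly_Mapping.keys (p * q)"
    using k by (simp add: in_keys_iff lookup_add)
  then show ?thesis
  proof (rule min_weight_eqI[OF _ wk])
    fix l assume "l \<in> Poly_Mapping.keys (p * q)"
    then obtain a b where "l = a + b" "a \<in> Poly_Mapping.keys p" "b \<in> Poly_Mapping.keys q"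
      using keys_mult[of p q] by blast
    then show "?m + ?n \<le> weight r w l"
      using min_weight_le[of a p r w] min_weight_le[of b q r w] by (simp add: weight_add)
  qed
qed

section \<open>Laurent polynomials with nonnegative coefficients\<close>

definition positive_polys :: "nat \<Rightarrow> laurent set" where
  "positive_polys r = {p \<in> polys r. p \<noteq> 0 \<and> (\<forall>h. Poly_Mapping.lookup p h \<ge> 0)}"

lemma positive_polys_single:
  "h \<in> exponents r \<Longrightarrow> c > 0 \<Longrightarrow> Poly_Mapping.single h c \<in> positive_polys r"
  by (auto simp: positive_polys_def polys_single lookup_single when_def simp flip: keys_eq_empty)

text \<open>Nonnegative coefficients cannot cancel.\<close>

lemma keys_add_positive_polys:
  assumes "p \<in> positive_polys r" "q \<in> positive_polys r"
  shows "Poly_Mapping.keys (p + q) = Poly_Mapping.keys p \<union> Poly_Mapping.keys q"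
  using assms by (auto simp: positive_polys_def in_keys_iff lookup_add add_nonneg_eq_0_iff)

lemma positive_polys_add:
  assumes "p \<in> positive_polys r" "q \<in> positive_polys r"
  shows "p + q \<in> positive_polys r"
  using assms keys_add_positive_polys[OF assms]
  by (auto simp: positive_polys_def lookup_add polys_add simp flip: keys_eq_empty)

text \<open>In general a sum may lose its terms of least weight by cancellation; positivity excludes
  this and turns the usual inequality into an equality.\<close>

lemma min_weight_add:
  assumes "p \<in> positive_polys r" "q \<in> positive_polys r"
  shows "min_weight r w (p + q) = min (min_weight r w p) (min_weight r w q)"
  using assms keys_add_positive_polys[OF assms]
  by (auto simp: min_weight_def image_Un positive_polys_def intro!: Min_Un)

lemma positive_polys_mult:
  assumes "p \<in> positive_polys r" "q \<in> positive_polys r"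
  shows "p * q \<in> positive_polys r"
proof -
  let ?s = "\<lambda>f h. Poly_Mapping.single h (Poly_Mapping.lookup f h)"
  have "p * q = (\<Sum>h\<in>Poly_Mapping.keys p. ?s p h) * (\<Sum>k\<in>Poly_Mapping.keys q. ?s q k)"
    by (simp only: sum_single_lookup)
  then have "Poly_Mapping.lookup (p * q) h \<ge> 0" for h
    using assms
    by (auto simp: sum_product mult_single lookup_sum lookup_single when_def positive_polys_def
        intro!: sum_nonneg)
  then show ?thesis using assms by (auto simp: positive_polys_def polys_mult)
qed

section \<open>Subtraction-free fractions and the valuations of a chart\<close>

definition positive_fractions :: "nat \<Rightarrow> (nat \<Rightarrow> 'a::field_char_0) \<Rightarrow> 'a set" where
  "positive_fractions r z =
     {laurent_val z p / laurent_val z q | p q. p \<in> positive_polys r \<and> q \<in> positive_polys r}"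

text \<open>The monomial valuation with \<open>z i\<close> of value \<open>w i\<close>; it is only specified on quotients of
  nonzero integral Laurent polynomials.\<close>

definition valuation :: "nat \<Rightarrow> (nat \<Rightarrow> 'a::field_char_0) \<Rightarrow> (nat \<Rightarrow> int) \<Rightarrow> 'a \<Rightarrow> int" where
  "valuation r z w f = (THE n. \<exists>p\<in>polys r - {0}. \<exists>q\<in>polys r - {0}.
     f = laurent_val z p / laurent_val z q \<and> n = min_weight r w p - min_weight r w q)"

context
  fixes r :: nat and z :: "nat \<Rightarrow> 'a::field_char_0"
  assumes fg: "free_generators r z"
begin

text \<open>Two representations of a fraction agree after cross-multiplication, by injectivity of
  evaluation, and \<open>min_weight\<close> is additive on products. Hence the definite description
  is unique.\<close>

lemma valuation_fraction:
  assumes "p \<in> polys r" "p \<noteq> 0" "q \<in> polys r" "q \<noteq> 0"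
  shows "valuation r z w (laurent_val z p / laurent_val z q) = min_weight r w p - min_weight r w q"
  unfolding valuation_def
proof (rule the_equality)
  fix n assume "\<exists>p'\<in>polys r - {0}. \<exists>q'\<in>polys r - {0}.
     laurent_val z p / laurent_val z q = laurent_val z p' / laurent_val z q' \<and>
     n = min_weight r w p' - min_weight r w q'"
  then obtain p' q' where *: "p' \<in> polys r" "p' \<noteq> 0" "q' \<in> polys r" "q' \<noteq> 0"
    "laurent_val z p / laurent_val z q = laurent_val z p' / laurent_val z q'"
    "n = min_weight r w p' - min_weight r w q'" by blast
  then have "laurent_val z (p * q') = laurent_val z (p' * q)"
    using assms by (simp add: laurent_val_mult[OF fg] laurent_val_eq_0_iff[OF fg] frac_eq_eq)
  then have "p * q' = p' * q"
    using * assms by (intro laurent_val_inj[OF fg] polys_mult) auto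
  then have "min_weight r w (p * q') = min_weight r w (p' * q)" by simp
  then show "n = min_weight r w p - min_weight r w q"
    using * assms by (simp add: min_weight_mult)
qed (use assms in blast)

lemma valuation_laurent_val:
  assumes "p \<in> polys r" "p \<noteq> 0"
  shows "valuation r z w (laurent_val z p) = min_weight r w p"
  \<comment> \<open>The denominator is the constant 1, kept as \<open>single 0 1\<close> so that the
    rules for single terms apply.\<close>
  using valuation_fraction[OF assms polys_single[OF exponents_0], of 1 w]
  by (simp add: laurent_val_single min_weight_single del: single_one flip: keys_eq_empty)

lemma laurent_val_positive_nonzero: "p \<in> positive_polys r \<Longrightarrow> laurent_val z p \<noteq> 0"
  by (simp add: positive_polys_def laurent_val_eq_0_iff[OF fg])

lemma positive_fractionsE:
  assumes "f \<in> positive_fractions r z"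
  obtains p q where "p \<in> positive_polys r" "q \<in> positive_polys r"
    "f = laurent_val z p / laurent_val z q" "laurent_val z p \<noteq> 0" "laurent_val z q \<noteq> 0"
    "\<And>w. valuation r z w f = min_weight r w p - min_weight r w q"
  using assms laurent_val_positive_nonzero valuation_fraction
  by (auto simp: positive_fractions_def positive_polys_def)

lemma positive_fractions_nonzero: "f \<in> positive_fractions r z \<Longrightarrow> f \<noteq> 0"
  by (elim positive_fractionsE) simp

lemma positive_fractionsI:
  assumes "p \<in> positive_polys r" "q \<in> positive_polys r" "f = laurent_val z p / laurent_val z q"
  shows "f \<in> positive_fractions r z \<and> valuation r z w f = min_weight r w p - min_weight r w q"
  using assms valuation_fraction by (auto simp: positive_fractions_def positive_polys_def)

text \<open>Over the common denominator the numerator is again a sum of positive polynomials, so the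
  exact formula of \<open>min_weight_add\<close> applies.\<close>

lemma valuation_add:
  assumes "f \<in> positive_fractions r z" "g \<in> positive_fractions r z"
  shows "f + g \<in> positive_fractions r z \<and>
    valuation r z w (f + g) = min (valuation r z w f) (valuation r z w g)"
proof -
  from assms(1) obtain p q where f: "p \<in> positive_polys r" "q \<in> positive_polys r"
    "f = laurent_val z p / laurent_val z q" "laurent_val z p \<noteq> 0" "laurent_val z q \<noteq> 0"
    "\<And>w. valuation r z w f = min_weight r w p - min_weight r w q"
    by (rule positive_fractionsE) blast
  from assms(2) obtain p' q' where g: "p' \<in> positive_polys r" "q' \<in> positive_polys r"
    "g = laurent_val z p' / laurent_val z q'" "laurent_val z p' \<noteq> 0" "laurent_val z q' \<noteq> 0"
    "\<And>w. valuation r z w g = min_weight r w p' - min_weight r w q'"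
    by (rule positive_fractionsE) blast
  have nz: "p \<noteq> 0" "q \<noteq> 0" "p' \<noteq> 0" "q' \<noteq> 0"
    and pol: "p \<in> polys r" "q \<in> polys r" "p' \<in> polys r" "q' \<in> polys r"
    using f g by (auto simp: positive_polys_def)
  have "f + g = laurent_val z (p * q' + p' * q) / laurent_val z (q * q')"
    using f g by (simp add: laurent_val_mult[OF fg] laurent_val_add pol field_simps)
  then have "f + g \<in> positive_fractions r z \<and> valuation r z w (f + g) =
      min_weight r w (p * q' + p' * q) - min_weight r w (q * q')"
    using f(1,2) g(1,2) by (intro positive_fractionsI positive_polys_add positive_polys_mult)
  moreover have "min_weight r w (p * q' + p' * q) =
      min (min_weight r w p + min_weight r w q') (min_weight r w p' + min_weight r w q)"
    using min_weight_add[of "p * q'" r "p' * q" w] f(1,2) g(1,2)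
    by (simp add: positive_polys_mult min_weight_mult nz)
  ultimately show ?thesis
    using f(6) g(6) by (auto simp: min_weight_mult nz)
qed

lemma valuation_mult:
  assumes "f \<in> positive_fractions r z" "g \<in> positive_fractions r z"
  shows "f * g \<in> positive_fractions r z \<and>
    valuation r z w (f * g) = valuation r z w f + valuation r z w g"
proof -
  from assms(1) obtain p q where f: "p \<in> positive_polys r" "q \<in> positive_polys r"
    "f = laurent_val z p / laurent_val z q" "laurent_val z p \<noteq> 0" "laurent_val z q \<noteq> 0"
    "\<And>w. valuation r z w f = min_weight r w p - min_weight r w q"
    by (rule positive_fractionsE) blast
  from assms(2) obtain p' q' where g: "p' \<in> positive_polys r" "q' \<in> positive_polys r"
    "g = laurent_val z p' / laurent_val z q'" "laurent_val z p' \<noteq> 0" "laurent_val z q' \<noteq> 0"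
    "\<And>w. valuation r z w g = min_weight r w p' - min_weight r w q'"
    by (rule positive_fractionsE) blast
  have nz: "p \<noteq> 0" "q \<noteq> 0" "p' \<noteq> 0" "q' \<noteq> 0"
    and pol: "p \<in> polys r" "q \<in> polys r" "p' \<in> polys r" "q' \<in> polys r"
    using f g by (auto simp: positive_polys_def)
  have "f * g = laurent_val z (p * p') / laurent_val z (q * q')"
    using f g by (simp add: laurent_val_mult[OF fg] pol)
  then have "f * g \<in> positive_fractions r z \<and> valuation r z w (f * g) =
      min_weight r w (p * p') - min_weight r w (q * q')"
    using f(1,2) g(1,2) by (intro positive_fractionsI positive_polys_mult)
  then show ?thesis
    using f(6) g(6) by (auto simp: min_weight_mult nz)
qed

lemma valuation_inverse:
  assumes "f \<in> positive_fractions r z"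
  shows "inverse f \<in> positive_fractions r z \<and> valuation r z w (inverse f) = - valuation r z w f"
proof -
  from assms obtain p q where f: "p \<in> positive_polys r" "q \<in> positive_polys r"
    "f = laurent_val z p / laurent_val z q" "laurent_val z p \<noteq> 0" "laurent_val z q \<noteq> 0"
    "\<And>w. valuation r z w f = min_weight r w p - min_weight r w q"
    by (rule positive_fractionsE) blast
  then show ?thesis
    using positive_fractionsI[of q p "inverse f" w] by simp
qed

lemma valuation_divide:
  assumes "f \<in> positive_fractions r z" "g \<in> positive_fractions r z"
  shows "valuation r z w (f / g) = valuation r z w f - valuation r z w g"
  using valuation_mult[of f "inverse g" w] valuation_inverse[OF assms(2), of w] assms(1)
  by (simp add: divide_inverse)

lemma valuation_laurent_monom_val:
  assumes "h \<in> exponents r"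
  shows "laurent_monom_val z h \<in> positive_fractions r z \<and>
    valuation r z w (laurent_monom_val z h) = weight r w h"
  using positive_fractionsI[OF positive_polys_single[OF assms, of 1]
      positive_polys_single[OF exponents_0, of 1], of "laurent_monom_val z h" w]
  by (simp add: laurent_val_single min_weight_single del: single_one)

lemma valuation_of_int:
  assumes "c > 0"
  shows "of_int c \<in> positive_fractions r z \<and> valuation r z w (of_int c) = 0"
  using positive_fractionsI[OF positive_polys_single[OF exponents_0 assms]
      positive_polys_single[OF exponents_0, of 1], of "of_int c" w] assms
  by (simp add: laurent_val_single min_weight_single del: single_one)

section \<open>Valuations of powers, products and sums\<close>

lemma valuation_power:
  assumes "f \<in> positive_fractions r z"
  shows "f ^ n \<in> positive_fractions r z \<and> valuation r z w (f ^ n) = int n * valuation r z w f"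
proof (induction n)
  case 0
  show ?case using valuation_of_int[of 1 w] by simp
next
  case (Suc n)
  then show ?case using valuation_mult[OF assms, of "f ^ n" w] by (simp add: algebra_simps)
qed

lemma valuation_power_int:
  assumes "f \<in> positive_fractions r z"
  shows "f powi n \<in> positive_fractions r z \<and> valuation r z w (f powi n) = n * valuation r z w f"
  using valuation_power[OF assms, of "nat n" w] valuation_inverse[OF assms, of w]
    valuation_power[of "inverse f" "nat (- n)" w]
  by (auto simp: power_int_def)

lemma valuation_prod:
  assumes "finite S" "\<And>i. i \<in> S \<Longrightarrow> f i \<in> positive_fractions r z"
  shows "prod f S \<in> positive_fractions r z \<and>
    valuation r z w (prod f S) = (\<Sum>i\<in>S. valuation r z w (f i))"
  using assms
proof (induction S rule: finite_induct)
  case empty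
  show ?case using valuation_of_int[of 1 w] by simp
next
  case (insert i S)
  then show ?case using valuation_mult[of "f i" "prod f S" w] by auto
qed

lemma valuation_sum:
  assumes "finite S" "S \<noteq> {}" "\<And>i. i \<in> S \<Longrightarrow> f i \<in> positive_fractions r z"
  shows "sum f S \<in> positive_fractions r z \<and>
    valuation r z w (sum f S) = (MIN i\<in>S. valuation r z w (f i))"
  using assms
proof (induction S rule: finite_ne_induct)
  case (insert i S)
  then show ?case using valuation_add[of "f i" "sum f S" w] by auto
qed auto

text \<open>Here \<open>x\<close> is any tuple of subtraction-free elements, later the other chart.
  The valuation of the chart \<open>z\<close> is monomial in \<open>x\<close> too, the weight of
  \<open>x i\<close> being its valuation.\<close>

lemma valuation_laurent_monom_of_positive:
  fixes x :: "nat \<Rightarrow> 'a"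
  assumes x: "\<And>i. i \<in> {1..r} \<Longrightarrow> x i \<in> positive_fractions r z" and h: "h \<in> exponents r"
  shows "laurent_monom_val x h \<in> positive_fractions r z \<and>
    valuation r z w (laurent_monom_val x h) = weight r (\<lambda>i. valuation r z w (x i)) h"
proof -
  let ?f = "\<lambda>i. x i powi Poly_Mapping.lookup h i"
  have "prod ?f {1..r} \<in> positive_fractions r z \<and>
      valuation r z w (prod ?f {1..r}) = (\<Sum>i\<in>{1..r}. valuation r z w (?f i))"
    using x by (intro valuation_prod) (auto intro!: conjunct1[OF valuation_power_int])
  moreover have "(\<Sum>i\<in>{1..r}. valuation r z w (?f i)) = weight r (\<lambda>i. valuation r z w (x i)) h"
    unfolding weight_def using x
    by (intro sum.cong) (simp_all add: valuation_power_int mult.commute)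
  ultimately show ?thesis
    by (simp add: laurent_monom_val_exponents[OF h])
qed

text \<open>Positive integer coefficients have valuation 0 and sums become minima. With coefficients
  of mixed sign, terms in \<open>x\<close> could cancel; hence the detour through fractions in
  \<open>global_monomial_eq_of_key\<close>.\<close>

lemma valuation_positive_poly_of_positive:
  fixes x :: "nat \<Rightarrow> 'a"
  assumes x: "\<And>i. i \<in> {1..r} \<Longrightarrow> x i \<in> positive_fractions r z" and p: "p \<in> positive_polys r"
  shows "laurent_val x p \<in> positive_fractions r z \<and>
    valuation r z w (laurent_val x p) = min_weight r (\<lambda>i. valuation r z w (x i)) p"
proof -
  let ?f = "\<lambda>h. of_int (Poly_Mapping.lookup p h) * laurent_monom_val x h"
  have f: "?f h \<in> positive_fractions r z \<and>
      valuation r z w (?f h) = weight r (\<lambda>i. valuation r z w (x i)) h"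
    if "h \<in> Poly_Mapping.keys p" for h
  proof -
    have "h \<in> exponents r" using p that by (auto simp: positive_polys_def polys_def)
    moreover have "Poly_Mapping.lookup p h > 0"
      using p that by (auto simp: positive_polys_def in_keys_iff order_less_le)
    ultimately show ?thesis
      using valuation_mult[of "of_int (Poly_Mapping.lookup p h)" "laurent_monom_val x h" w]
        valuation_of_int[of "Poly_Mapping.lookup p h" w]
        valuation_laurent_monom_of_positive[where x = x and h = h and w = w] x by simp
  qed
  have "sum ?f (Poly_Mapping.keys p) \<in> positive_fractions r z \<and>
      valuation r z w (sum ?f (Poly_Mapping.keys p)) = (MIN h\<in>Poly_Mapping.keys p. valuation r z w (?f h))"
    using f p by (intro valuation_sum) (auto simp: positive_polys_def)
  then show ?thesis
    using f by (simp add: laurent_val_def min_weight_def)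
qed

section \<open>From \<open>Q_sf\<close> to positive fractions\<close>

lemma nat_poly_val_positive:
  assumes "p \<in> polys r" "p \<noteq> 0"
  obtains q where "q \<in> positive_polys r" "nat_poly_val z p = laurent_val z q"
proof
  let ?K = "Poly_Mapping.keys p"
  let ?f = "\<lambda>m. Poly_Mapping.single (Poly_Mapping.map int m) (int (Poly_Mapping.lookup p m))"
  show "nat_poly_val z p = laurent_val z (sum ?f ?K)"
    by (simp add: nat_poly_val_def laurent_val_sum laurent_val_single monom_val_conv_laurent)
  have "sum ?f ?K \<in> polys r"
    using assms(1) by (intro polys_sum polys_single exponents_map) (auto simp: polys_def)
  moreover have nonneg: "Poly_Mapping.lookup (?f m) h \<ge> 0" for m h
    by (simp add: lookup_single when_def)
  moreover have "sum ?f ?K \<noteq> 0"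
  proof
    assume "sum ?f ?K = 0"
    obtain m where m: "m \<in> ?K"
      using assms(2) by (metis all_not_in_conv poly_mapping_eqI in_keys_iff lookup_zero)
    \<comment> \<open>All contributions are nonnegative, so the coefficient at the exponent of
      \<open>m\<close> is at least that of its own term, which is positive.\<close>
    have "Poly_Mapping.lookup (?f m) (Poly_Mapping.map int m) \<le>
        Poly_Mapping.lookup (sum ?f ?K) (Poly_Mapping.map int m)"
      unfolding lookup_sum using m nonneg by (intro member_le_sum) auto
    then show False
      using m unfolding \<open>sum ?f ?K = 0\<close> by (simp add: in_keys_iff)
  qed
  ultimately show "sum ?f ?K \<in> positive_polys r"
    by (auto simp: positive_polys_def lookup_sum intro!: sum_nonneg)
qed

lemma Q_sf_subset_positive_fractions: "Q_sf r z \<subseteq> positive_fractions r z"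
proof
  fix f assume "f \<in> Q_sf r z"
  then obtain p q where "p \<in> polys r" "p \<noteq> 0" "q \<in> polys r" "q \<noteq> 0"
    "f = nat_poly_val z p / nat_poly_val z q" unfolding Q_sf_def by blast
  then show "f \<in> positive_fractions r z"
    unfolding positive_fractions_def mem_Collect_eq by (metis nat_poly_val_positive)
qed

text \<open>The exponent splits into its positive part \<open>a\<close> and its negative part
  \<open>b\<close>, and the monomial is the quotient of two ordinary ones.\<close>

lemma laurent_monom_val_in_Q_sf:
  assumes "h \<in> exponents r"
  shows "laurent_monom_val z h \<in> Q_sf r z"
proof -
  define a where "a = Poly_Mapping.map nat h"
  define b where "b = Poly_Mapping.map (\<lambda>n. nat (- n)) h"
  have ab: "a \<in> exponents r" "b \<in> exponents r"
    using assms by (auto simp: a_def b_def intro!: exponents_map)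
  have ab': "Poly_Mapping.map int a \<in> exponents r" "Poly_Mapping.map int b \<in> exponents r"
    using ab by (auto intro!: exponents_map)
  have "h + Poly_Mapping.map int b = Poly_Mapping.map int a"
    by (rule poly_mapping_eqI) (auto simp: a_def b_def lookup_add map.rep_eq when_def)
  then have "laurent_monom_val z h * monom_val z b = monom_val z a"
    by (metis laurent_monom_val_add[OF fg assms ab'(2)] monom_val_conv_laurent)
  moreover have "monom_val z b \<noteq> 0"
    using laurent_monom_val_nonzero[OF fg ab'(2)] by (simp add: monom_val_conv_laurent)
  ultimately have "laurent_monom_val z h = nat_poly_val z (Poly_Mapping.single a 1) /
      nat_poly_val z (Poly_Mapping.single b 1)"
    by (simp add: nat_poly_val_def field_simps)
  moreover have "Poly_Mapping.single c (1::nat) \<noteq> 0" for c :: "nat \<Rightarrow>\<^sub>0 nat"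
    by (metis lookup_single_eq lookup_zero zero_neq_one)
  ultimately show ?thesis
    unfolding Q_sf_def using polys_single[OF ab(1)] polys_single[OF ab(2)] by blast
qed

lemma generator_in_Q_sf:
  assumes "i \<in> {1..r}"
  shows "z i \<in> Q_sf r z"
  using laurent_monom_val_in_Q_sf[of "Poly_Mapping.single i 1"] assms
  by (simp add: exponents_def laurent_monom_val_def)

end

subsection \<open>Global monomials in two charts\<close>

text \<open>Yields (i) by contradiction, because its conclusion would place \<open>u\<close> among
  the global monomials of the chart \<open>x\<close>.\<close>

lemma global_monomial_eq_of_key:
  fixes x y :: "nat \<Rightarrow> 'a::field_char_0"
  assumes fgx: "free_generators r x" and fgy: "free_generators r y" and Qsf: "Q_sf r x = Q_sf r y"
    and g: "g \<in> exponents r" and p: "p \<in> polys r" "laurent_val x p = laurent_monom_val y g"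
    and h: "h \<in> Poly_Mapping.keys p" and d: "laurent_monom_val x h \<in> laurent_ring r y"
  shows "laurent_monom_val y g = laurent_monom_val x h"
proof -
  let ?u = "laurent_monom_val y g"
  have h_exp: "h \<in> exponents r" using p(1) h by (auto simp: polys_def)
  have p_nz: "p \<noteq> 0" using h by auto
  from d obtain q where q: "q \<in> polys r" "laurent_val y q = laurent_monom_val x h"
    by (auto simp: laurent_ring_def)
  have "q \<noteq> 0"
    using q(2) laurent_monom_val_nonzero[OF fgx h_exp] by auto
  have x_pos: "x i \<in> positive_fractions r y" if "i \<in> {1..r}" for i
    using generator_in_Q_sf[OF fgx that] Q_sf_subset_positive_fractions[OF fgy] Qsf by auto
  have u_pos: "?u \<in> positive_fractions r x"
    using laurent_monom_val_in_Q_sf[OF fgy g] Q_sf_subset_positive_fractions[OF fgx] Qsf by auto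
  \<comment> \<open>\<open>p\<close> may have negative coefficients, so its valuation cannot be read
    off its terms directly. A subtraction-free representation \<open>a / b\<close> of the same
    element is compared with it through \<open>a = p * b\<close>.\<close>
  then obtain a b where ab: "a \<in> positive_polys r" "b \<in> positive_polys r"
    "?u = laurent_val x a / laurent_val x b" "laurent_val x b \<noteq> 0"
    by (rule positive_fractionsE[OF fgx])
  then have ab_polys: "a \<in> polys r" "b \<in> polys r" "b \<noteq> 0"
    by (auto simp: positive_polys_def)
  have "laurent_val x (p * b) = laurent_val x a"
    using ab(3,4) p by (simp add: laurent_val_mult[OF fgx] ab_polys)
  then have a_eq: "a = p * b"
    using p(1) ab_polys by (metis laurent_val_inj[OF fgx] polys_mult)
  have weight_le: "weight r w g \<le> weight r w k" if k: "k \<in> Poly_Mapping.keys q" for w k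
  proof -
    \<comment> \<open>The valuation is monomial in \<open>y\<close> with weights \<open>w\<close>;
      \<open>?w\<close> collects the values it gives to the generators \<open>x i\<close>.\<close>
    let ?w = "\<lambda>i. valuation r y w (x i)"
    have "weight r w g = valuation r y w (laurent_val x a / laurent_val x b)"
      using valuation_laurent_monom_val[OF fgy g] ab(3) by simp
    also have "\<dots> = min_weight r ?w a - min_weight r ?w b"
      using valuation_positive_poly_of_positive[OF fgy x_pos ab(1), where w = w]
        valuation_positive_poly_of_positive[OF fgy x_pos ab(2), where w = w]
      by (simp add: valuation_divide[OF fgy])
    \<comment> \<open>\<open>min_weight\<close> is additive on products whatever the signs of the
      coefficients, so the contribution of \<open>b\<close> drops out.\<close>
    also have "\<dots> = min_weight r ?w p"
      by (simp add: a_eq min_weight_mult p_nz ab_polys(3))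
    also have "\<dots> \<le> weight r ?w h"
      by (rule min_weight_le[OF h])
    also have "\<dots> = valuation r y w (laurent_monom_val x h)"
      using valuation_laurent_monom_of_positive[OF fgy x_pos h_exp] by simp
    \<comment> \<open>\<open>y\<close> is the chart that defines the valuation, so \<open>q\<close>
      may have coefficients of any sign.\<close>
    also have "\<dots> = min_weight r w q"
      using valuation_laurent_val[OF fgy q(1) \<open>q \<noteq> 0\<close>] q(2) by simp
    also have "\<dots> \<le> weight r w k"
      by (rule min_weight_le[OF k])
    finally show ?thesis .
  qed
  have keys_q: "k = g" if k: "k \<in> Poly_Mapping.keys q" for k
  proof (rule poly_mapping_eqI)
    fix i
    \<comment> \<open>Weighting by the difference of the exponents makes the inequality say that a
      sum of squares is at most zero.\<close>
    let ?d = "\<lambda>i. Poly_Mapping.lookup (g - k) i"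
    have k_exp: "k \<in> exponents r" using q(1) k by (auto simp: polys_def)
    have "(\<Sum>i\<in>{1..r}. ?d i * ?d i) = weight r ?d g - weight r ?d k"
      unfolding weight_diff[symmetric] by (simp add: weight_def)
    then have "(\<Sum>i\<in>{1..r}. ?d i * ?d i) \<le> 0"
      using weight_le[OF k, of ?d] by simp
    then have "(\<Sum>i\<in>{1..r}. ?d i * ?d i) = 0"
      by (intro antisym sum_nonneg) auto
    then have "i \<in> {1..r} \<Longrightarrow> ?d i = 0"
      by (subst (asm) sum_nonneg_eq_0_iff) auto
    then show "Poly_Mapping.lookup k i = Poly_Mapping.lookup g i"
      using lookup_exponents_eq_0[OF g, of i] lookup_exponents_eq_0[OF k_exp, of i]
      by (cases "i \<in> {1..r}") (auto simp: lookup_minus)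
  qed
  define c where "c = Poly_Mapping.lookup q g"
  have "q = Poly_Mapping.single g c"
    using keys_q by (intro poly_mapping_eqI) (auto simp: c_def lookup_single when_def in_keys_iff)
  then have xh: "laurent_monom_val x h = of_int c * ?u"
    using q(2) by (simp add: laurent_val_single)
  \<comment> \<open>Comparing coefficients at \<open>h\<close> exhibits \<open>c\<close> as a
    divisor of 1, since \<open>p\<close> has integer coefficients.\<close>
  have "laurent_val x (Poly_Mapping.single h 1) = laurent_val x (Poly_Mapping.single 0 c * p)"
    by (simp add: laurent_val_mult[OF fgx polys_single[OF exponents_0] p(1)] laurent_val_single p(2) xh)
  then have "Poly_Mapping.single h 1 = Poly_Mapping.single 0 c * p"
    by (intro laurent_val_inj[OF fgx] polys_mult polys_single p(1) h_exp exponents_0)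
  then have "1 = Poly_Mapping.lookup (Poly_Mapping.map ((*) c) p) h"
    by (metis lookup_single_eq mult_map_scale_conv_mult)
  then have "1 = c * Poly_Mapping.lookup p h"
    by (simp add: map.rep_eq when_def split: if_splits)
  then have "c = 1 \<or> c = -1"
    by (metis zmult_eq_1_iff)
  \<comment> \<open>For \<open>c = -1\<close> a sum of two subtraction-free elements would vanish,
    but such a sum is again subtraction-free and hence nonzero.\<close>
  moreover have "c \<noteq> -1"
  proof
    assume "c = -1"
    then have "laurent_monom_val x h + ?u = 0" using xh by simp
    then show False
      using valuation_add[OF fgx conjunct1[OF valuation_laurent_monom_val[OF fgx h_exp]] u_pos]
        positive_fractions_nonzero[OF fgx] by metis
  qed
  ultimately show ?thesis using xh by simp
qed

theorem corollary1p5: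
  fixes r :: nat and T :: "'t set" and z :: "'t \<Rightarrow> nat \<Rightarrow> 'a::field_char_0"
    and t0 :: 't and u :: 'a
  assumes "positive_space r T z"
    and "t0 \<in> T"
    and "u \<in> global_monomials r T z"
    and "u \<notin> chart_global_monomials r T z t0"
  shows "(\<forall>h\<in>Poly_Mapping.keys (laurent_expansion r (z t0) u).
            laurent_monom_val (z t0) h \<notin> chart_global_monomials r T z t0) \<and>
         ({monom_val (z t0) m | m. m \<in> exponents r} \<subseteq> chart_global_monomials r T z t0 \<longrightarrow>
            (\<forall>h\<in>Poly_Mapping.keys (laurent_expansion r (z t0) u). proper_exponent r h))"
proof -
  from assms(3) obtain t g where t: "t \<in> T" and g: "g \<in> exponents r"
    and u: "u = laurent_monom_val (z t) g" "u \<in> coord_algebra r T z"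
    by (auto simp: global_monomials_def chart_global_monomials_def)
  have fg: "free_generators r (z t0)" "free_generators r (z t)"
    and Qsf: "Q_sf r (z t0) = Q_sf r (z t)"
    using assms(1,2) t unfolding positive_space_def by blast+
  from u(2) assms(2) obtain p where p: "p \<in> polys r" "laurent_val (z t0) p = u"
    by (auto simp: coord_algebra_def laurent_ring_def)
  have expansion: "laurent_expansion r (z t0) u = p"
    using laurent_expansion_laurent_val[OF fg(1) p(1)] p(2) by simp
  have i: "laurent_monom_val (z t0) h \<notin> chart_global_monomials r T z t0"
    if h: "h \<in> Poly_Mapping.keys p" for h
  proof
    assume M: "laurent_monom_val (z t0) h \<in> chart_global_monomials r T z t0"
    \<comment> \<open>Lying in the coordinate algebra means being Laurent in every chart, in
      particular in the one where \<open>u\<close> is a monomial.\<close>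
    then have "laurent_monom_val (z t0) h \<in> laurent_ring r (z t)"
      using t by (auto simp: chart_global_monomials_def coord_algebra_def)
    then have "u = laurent_monom_val (z t0) h"
      using global_monomial_eq_of_key[OF fg Qsf g p(1) _ h] p(2) u(1) by simp
    with M assms(4) show False by simp
  qed
  have ii: "proper_exponent r h"
    if nonneg: "{monom_val (z t0) m | m. m \<in> exponents r} \<subseteq> chart_global_monomials r T z t0"
      and h: "h \<in> Poly_Mapping.keys p" for h
  proof (rule ccontr)
    assume not_proper: "\<not> proper_exponent r h"
    have h_exp: "h \<in> exponents r" using p(1) h by (auto simp: polys_def)
    \<comment> \<open>Coordinates outside \<open>{1..r}\<close> vanish, so a non-proper exponent is
      nonnegative everywhere and comes from an ordinary monomial.\<close>
    have "Poly_Mapping.lookup h i \<ge> 0" for i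
      using not_proper lookup_exponents_eq_0[OF h_exp, of i]
      by (cases "i \<in> {1..r}") (auto simp: proper_exponent_def not_less)
    then have "Poly_Mapping.map int (Poly_Mapping.map nat h) = h"
      by (intro poly_mapping_eqI) (auto simp: map.rep_eq when_def not_le antisym)
    then have "laurent_monom_val (z t0) h = monom_val (z t0) (Poly_Mapping.map nat h)"
      by (simp add: monom_val_conv_laurent)
    moreover have "Poly_Mapping.map nat h \<in> exponents r"
      using h_exp by (rule exponents_map) simp
    ultimately have "laurent_monom_val (z t0) h \<in> chart_global_monomials r T z t0"
      using nonneg by blast
    with i[OF h] show False by contradiction
  qed
  show ?thesis using i ii expansion by simp
qed

end
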